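(* The integral relations (I)--(IV) listed in the context, which hold for a classical solution $x$ of the Cauchy--Goursat problem, can be recast, via integration by parts, into a unified Volterra-type integral equation for the function $x(s,t)$.
   Context: Setting: $c>0$, $\Omega=\{(s,t): s>0,\ t>0,\ s+t>c\}$, $\lambda\in C^1$ with $\lambda\ne0$, and the equation is $2\lambda(s+t)x_{st}+\lambda'(s+t)(x_s+x_t)=0$ on $\Omega$. The boundary data $\{g,h,f,n\}$ are: $x(s,0)=g(s)$ for $s\ge c$; $x(0,t)=h(t)$ for $t\ge c$; $x(s,c-s)=f(s)$ and $(\partial_s+\partial_t)x(s,c-s)=n(s)$ for $0\le s\le c$. A classical solution is a function $x\in C^2(\Omega)$ that solves the equation and attains these boundary data pointwise. The integral relations are: (I) for $s>c$, $t>c$: $\int_0^s\lambda(\sigma+t)x_\sigma(\sigma,t)\,d\sigma+\int_0^t\lambda(s+\tau)x_\tau(s,\tau)\,d\tau=\int_c^s\lambda(\sigma)x_\sigma(\sigma,0)\,d\sigma+\int_0^c\lambda(c)n(\sigma)\,d\sigma+\int_c^t\lambda(\tau)x_\tau(0,\tau)\,d\tau$; (II) for $0\le s\le c$, $t>c$: $\int_0^s\lambda(\sigma+t)x_\sigma(\sigma,t)\,d\sigma+\int_{c-s}^t\lambda(s+\tau)x_\tau(s,\tau)\,d\tau=\int_0^s\lambda(c)n(\sigma)\,d\sigma+\int_c^t\lambda(\tau)x_\tau(0,\tau)\,d\tau$; (III) for $s>c$, $0\le t\le c$: $\int_{c-t}^s\lambda(\sigma+t)x_\sigma(\sigma,t)\,d\sigma+\int_0^t\lambda(s+\tau)x_\tau(s,\tau)\,d\tau=\int_0^t\lambda(c)n(c-\tau)\,d\tau+\int_c^s\lambda(\sigma)x_\sigma(\sigma,0)\,d\sigma$;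 (IV) for $0<s<c$, $0<t<c$, $s+t>c$: $\int_{c-t}^s\lambda(\sigma+t)x_\sigma(\sigma,t)\,d\sigma+\int_{c-s}^t\lambda(s+\tau)x_\tau(s,\tau)\,d\tau=\int_{c-t}^s\lambda(c)n(\sigma)\,d\sigma$. With $\xi^+=\max(\xi,0)$, the unified equation meant is $$\begin{aligned}2\lambda(s+t)x(s,t)={}&\int_{(c-t)^+}^{s}\lambda'(\sigma+t)x(\sigma,t)\,d\sigma+\int_{(c-s)^+}^{t}\lambda'(s+\tau)x(s,\tau)\,d\tau\\&+\lambda(\max(c,t))\,x((c-t)^+,t)+\lambda(\max(s,c))\,x(s,(c-s)^+)\\&+\int_{(c-t)^+}^{\min(c,s)}\lambda(c)\,(x_\sigma+x_\tau)\big|_{\sigma+\tau=c}\,d\sigma\\&+\int_{\min(c,s)}^{s}\lambda(\sigma+(c-s)^+)\,x_\sigma(\sigma,(c-s)^+)\,d\sigma\\&+\int_{\min(c,t)}^{t}\lambda((c-t)^++\tau)\,x_\tau((c-t)^+,\tau)\,d\tau .\end{aligned}$$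
   Formalization: A classical solution is additionally required to be C^1 up to the boundary of Ω; with x in C^2(Ω) only, boundary values need not be related to the interior and the relations can fail (e.g. λ=1, x=0 except x(s,0)=s−c). *)

theory Defs
  imports "HOL-Analysis.Analysis"
begin

definition Omega :: "real \<Rightarrow> (real \<times> real) set" where
  "Omega c = {(s, t). 0 < s \<and> 0 < t \<and> c < s + t}"

definition Omega_bar :: "real \<Rightarrow> (real \<times> real) set" where
  "Omega_bar c = {(s, t). 0 \<le> s \<and> 0 \<le> t \<and> c \<le> s + t}"

lemma closure_Omega: "closure (Omega c) = Omega_bar c"
proof
  have eq: "Omega_bar c = {p. 0 \<le> fst p} \<inter> {p. 0 \<le> snd p} \<inter> {p. c \<le> fst p + snd p}"
    by (auto simp: Omega_bar_def)
  have "closed (Omega_bar c)"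
    unfolding eq by (intro closed_Int closed_Collect_le continuous_intros)
  moreover have "Omega c \<subseteq> Omega_bar c"
    by (auto simp: Omega_def Omega_bar_def)
  ultimately show "closure (Omega c) \<subseteq> Omega_bar c"
    by (rule closure_minimal[rotated])
next
  show "Omega_bar c \<subseteq> closure (Omega c)"
  proof
    fix p assume p: "p \<in> Omega_bar c"
    define u where "u k = (fst p + inverse (real (Suc k)), snd p + inverse (real (Suc k)))" for k
    have "u k \<in> Omega c" for k
    proof -
      obtain e where e: "e = inverse (real (Suc k))" by simp
      then have "0 < e" by simp
      moreover have "u k = (fst p + e, snd p + e)" by (simp add: u_def e)
      ultimately show ?thesis
        using p by (auto simp: Omega_def Omega_bar_def)
    qed
    moreover have "u \<longlonglongrightarrow> (fst p + 0, snd p + 0)"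
      unfolding u_def by (intro tendsto_intros LIMSEQ_inverse_real_of_nat)
    ultimately show "p \<in> closure (Omega c)"
      by (auto simp: closure_sequential)
  qed
qed

text \<open>Partial derivatives taken within a set: ordinary ones at interior points, one-sided ones
  at boundary points. Every nonempty axis-parallel slice of \<open>Omega_bar c\<close> is a
  closed half-line, so these derivatives are unique where they exist.\<close>

definition Ds :: "(real \<times> real) set \<Rightarrow> (real \<Rightarrow> real \<Rightarrow> real) \<Rightarrow> real \<Rightarrow> real \<Rightarrow> real" where
  "Ds S x s t = vector_derivative (\<lambda>\<sigma>. x \<sigma> t) (at s within {\<sigma>. (\<sigma>, t) \<in> S})"

definition Dt :: "(real \<times> real) set \<Rightarrow> (real \<Rightarrow> real \<Rightarrow> real) \<Rightarrow> real \<Rightarrow> real \<Rightarrow> real" where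
  "Dt S x s t = vector_derivative (\<lambda>\<tau>. x s \<tau>) (at t within {\<tau>. (s, \<tau>) \<in> S})"

definition C1_on :: "(real \<times> real) set \<Rightarrow> (real \<Rightarrow> real \<Rightarrow> real) \<Rightarrow> bool" where
  "C1_on S x \<longleftrightarrow>
     (\<forall>(s, t) \<in> S. (\<lambda>\<sigma>. x \<sigma> t) differentiable (at s within {\<sigma>. (\<sigma>, t) \<in> S}) \<and>
                  (\<lambda>\<tau>. x s \<tau>) differentiable (at t within {\<tau>. (s, \<tau>) \<in> S})) \<and>
     continuous_on S (\<lambda>(s, t). x s t) \<and>
     continuous_on S (\<lambda>(s, t). Ds S x s t) \<and>
     continuous_on S (\<lambda>(s, t). Dt S x s t)"

definition C2_on :: "(real \<times> real) set \<Rightarrow> (real \<Rightarrow> real \<Rightarrow> real) \<Rightarrow> bool" where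
  "C2_on S x \<longleftrightarrow> C1_on S x \<and> C1_on S (Ds S x) \<and> C1_on S (Dt S x)"

text \<open>The boundary datum \<open>n\<close> and the integral relations involve first derivatives of \<open>x\<close> on the
  boundary of \<open>Omega c\<close>. A classical solution is therefore \<open>C\<^sup>2\<close> in the open domain
  and \<open>C\<^sup>1\<close> up to the boundary; nothing is required of second derivatives at the boundary.\<close>

definition classical_solution ::
  "real \<Rightarrow> (real \<Rightarrow> real) \<Rightarrow> (real \<Rightarrow> real) \<Rightarrow> (real \<Rightarrow> real) \<Rightarrow> (real \<Rightarrow> real) \<Rightarrow>
   (real \<Rightarrow> real) \<Rightarrow> (real \<Rightarrow> real) \<Rightarrow> (real \<Rightarrow> real \<Rightarrow> real) \<Rightarrow> bool" where
  "classical_solution c l l' g h f n x \<longleftrightarrow>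
     C2_on (Omega c) x \<and> C1_on (Omega_bar c) x \<and>
     (\<forall>(s, t) \<in> Omega c.
        2 * l (s + t) * Dt (Omega c) (Ds (Omega c) x) s t
        + l' (s + t) * (Ds (Omega c) x s t + Dt (Omega c) x s t) = 0) \<and>
     (\<forall>s\<ge>c. x s 0 = g s) \<and>
     (\<forall>t\<ge>c. x 0 t = h t) \<and>
     (\<forall>s\<in>{0..c}. x s (c - s) = f s) \<and>
     (\<forall>s\<in>{0..c}. Ds (Omega_bar c) x s (c - s) + Dt (Omega_bar c) x s (c - s) = n s)"

definition relation_I ::
  "real \<Rightarrow> (real \<Rightarrow> real) \<Rightarrow> (real \<Rightarrow> real) \<Rightarrow> (real \<Rightarrow> real \<Rightarrow> real) \<Rightarrow> bool" where
  "relation_I c l n x \<longleftrightarrow> (\<forall>s t. s > c \<and> t > c \<longrightarrow>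
     integral {0..s} (\<lambda>\<sigma>. l (\<sigma> + t) * Ds (Omega_bar c) x \<sigma> t)
     + integral {0..t} (\<lambda>\<tau>. l (s + \<tau>) * Dt (Omega_bar c) x s \<tau>)
     = integral {c..s} (\<lambda>\<sigma>. l \<sigma> * Ds (Omega_bar c) x \<sigma> 0)
     + integral {0..c} (\<lambda>\<sigma>. l c * n \<sigma>)
     + integral {c..t} (\<lambda>\<tau>. l \<tau> * Dt (Omega_bar c) x 0 \<tau>))"

definition relation_II ::
  "real \<Rightarrow> (real \<Rightarrow> real) \<Rightarrow> (real \<Rightarrow> real) \<Rightarrow> (real \<Rightarrow> real \<Rightarrow> real) \<Rightarrow> bool" where
  "relation_II c l n x \<longleftrightarrow> (\<forall>s t. 0 \<le> s \<and> s \<le> c \<and> t > c \<longrightarrow>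
     integral {0..s} (\<lambda>\<sigma>. l (\<sigma> + t) * Ds (Omega_bar c) x \<sigma> t)
     + integral {c - s..t} (\<lambda>\<tau>. l (s + \<tau>) * Dt (Omega_bar c) x s \<tau>)
     = integral {0..s} (\<lambda>\<sigma>. l c * n \<sigma>)
     + integral {c..t} (\<lambda>\<tau>. l \<tau> * Dt (Omega_bar c) x 0 \<tau>))"

definition relation_III ::
  "real \<Rightarrow> (real \<Rightarrow> real) \<Rightarrow> (real \<Rightarrow> real) \<Rightarrow> (real \<Rightarrow> real \<Rightarrow> real) \<Rightarrow> bool" where
  "relation_III c l n x \<longleftrightarrow> (\<forall>s t. s > c \<and> 0 \<le> t \<and> t \<le> c \<longrightarrow>
     integral {c - t..s} (\<lambda>\<sigma>. l (\<sigma> + t) * Ds (Omega_bar c) x \<sigma> t)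
     + integral {0..t} (\<lambda>\<tau>. l (s + \<tau>) * Dt (Omega_bar c) x s \<tau>)
     = integral {0..t} (\<lambda>\<tau>. l c * n (c - \<tau>))
     + integral {c..s} (\<lambda>\<sigma>. l \<sigma> * Ds (Omega_bar c) x \<sigma> 0))"

definition relation_IV ::
  "real \<Rightarrow> (real \<Rightarrow> real) \<Rightarrow> (real \<Rightarrow> real) \<Rightarrow> (real \<Rightarrow> real \<Rightarrow> real) \<Rightarrow> bool" where
  "relation_IV c l n x \<longleftrightarrow> (\<forall>s t. 0 < s \<and> s < c \<and> 0 < t \<and> t < c \<and> s + t > c \<longrightarrow>
     integral {c - t..s} (\<lambda>\<sigma>. l (\<sigma> + t) * Ds (Omega_bar c) x \<sigma> t)
     + integral {c - s..t} (\<lambda>\<tau>. l (s + \<tau>) * Dt (Omega_bar c) x s \<tau>)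
     = integral {c - t..s} (\<lambda>\<sigma>. l c * n \<sigma>))"

definition integral_relations ::
  "real \<Rightarrow> (real \<Rightarrow> real) \<Rightarrow> (real \<Rightarrow> real) \<Rightarrow> (real \<Rightarrow> real \<Rightarrow> real) \<Rightarrow> bool" where
  "integral_relations c l n x \<longleftrightarrow>
     relation_I c l n x \<and> relation_II c l n x \<and> relation_III c l n x \<and> relation_IV c l n x"

abbreviation pos_part :: "real \<Rightarrow> real" where
  "pos_part \<xi> \<equiv> max \<xi> 0"

definition unified_equation ::
  "real \<Rightarrow> (real \<Rightarrow> real) \<Rightarrow> (real \<Rightarrow> real) \<Rightarrow> (real \<Rightarrow> real \<Rightarrow> real) \<Rightarrow> bool" where
  "unified_equation c l l' x \<longleftrightarrow> (\<forall>(s, t) \<in> Omega_bar c.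
     2 * l (s + t) * x s t =
       integral {pos_part (c - t)..s} (\<lambda>\<sigma>. l' (\<sigma> + t) * x \<sigma> t)
     + integral {pos_part (c - s)..t} (\<lambda>\<tau>. l' (s + \<tau>) * x s \<tau>)
     + l (max c t) * x (pos_part (c - t)) t
     + l (max s c) * x s (pos_part (c - s))
     + integral {pos_part (c - t)..min c s}
         (\<lambda>\<sigma>. l c * (Ds (Omega_bar c) x \<sigma> (c - \<sigma>) + Dt (Omega_bar c) x \<sigma> (c - \<sigma>)))
     + integral {min c s..s}
         (\<lambda>\<sigma>. l (\<sigma> + pos_part (c - s)) * Ds (Omega_bar c) x \<sigma> (pos_part (c - s)))
     + integral {min c t..t}
         (\<lambda>\<tau>. l (pos_part (c - t) + \<tau>) * Dt (Omega_bar c) x (pos_part (c - t)) \<tau>))"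

end

theory Submission
  imports Defs
begin

text \<open>Put \<open>a = l (s + t) * x\<^sub>s\<close> and \<open>b = l (s + t) * x\<^sub>t\<close>. The differential equation is
\<open>a\<^sub>t + b\<^sub>s = 0\<close>, that is, the form \<open>a ds - b dt\<close> is closed. The relations (I)--(IV) say that its
integrals along two paths with the same end points agree: one path follows the two characteristics
through \<open>(s, t)\<close>, the other one the boundary of the domain. Both paths can be described for
all positions of \<open>(s, t)\<close> at once with positive parts and minima, and the result is
\<open>characteristic_relation\<close>, the pivot of the proof.

A classical solution satisfies it because a closed form has a potential
(\<open>closed_field_has_potential\<close>). Second derivatives may be singular at the boundary, so the potential is
used for the form translated by \<open>(e, e)\<close> into the open domain, and then \<open>e\<close> tends to \<open>0\<close>
(\<open>classical_solution_characteristic_relation\<close>).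

For any \<open>x\<close> that is \<open>C\<^sup>1\<close> up to the boundary and has datum \<open>n\<close> on the diagonal, each of the two sides of the claimed equivalence is the
characteristic relation at all points of the closed domain. For (I)--(IV) this is a case
distinction, completed by continuity on the lines \<open>s = c\<close> and \<open>t = c\<close>
(\<open>integral_relations_iff_characteristic_relation\<close>); for the unified equation it is one integration by
parts along each characteristic (\<open>unified_equation_iff_characteristic_relation\<close>).\<close>

section \<open>Closed forms in the plane\<close>

lemma open_contains_rectangle:
  fixes s t :: real
  assumes "open W" and "(s, t) \<in> W"
  obtains d where "d > 0" and "{s - d..s + d} \<times> {t - d..t + d} \<subseteq> W"
proof -
  obtain A B where AB: "open A" "open B" "(s, t) \<in> A \<times> B" "A \<times> B \<subseteq> W"
    using open_prod_elim[OF assms] by blast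
  then obtain d1 d2 where "d1 > 0" "cball s d1 \<subseteq> A" "d2 > 0" "cball t d2 \<subseteq> B"
    by (meson SigmaD1 SigmaD2 open_contains_cball)
  then show ?thesis
    using AB(4) by (intro that[of "min d1 d2"]) (auto simp: cball_eq_atLeastAtMost subset_iff min_def split: if_splits)
qed

text \<open>Peano's form of the symmetry of second derivatives: the increment of \<open>f\<close> in the first variable is an
integral of \<open>f1\<close>, and differentiating it in the second variable under the integral sign turns it
into an increment of \<open>f2\<close>. The differential equation contains only one of the two mixed derivatives
of \<open>x\<close>; this lemma supplies the other.\<close>

lemma mixed_partials_commute:
  fixes f f1 f2 f12 :: "real \<Rightarrow> real \<Rightarrow> real"
  assumes W: "open W" "(s, t) \<in> W"
    and f1: "\<And>s t. (s, t) \<in> W \<Longrightarrow> ((\<lambda>\<sigma>. f \<sigma> t) has_real_derivative f1 s t) (at s)"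
    and f2: "\<And>s t. (s, t) \<in> W \<Longrightarrow> ((\<lambda>\<tau>. f s \<tau>) has_real_derivative f2 s t) (at t)"
    and f12: "\<And>s t. (s, t) \<in> W \<Longrightarrow> ((\<lambda>\<tau>. f1 s \<tau>) has_real_derivative f12 s t) (at t)"
    and cont: "continuous_on W (\<lambda>(s, t). f12 s t)"
  shows "((\<lambda>\<sigma>. f2 \<sigma> t) has_real_derivative f12 s t) (at s)"
proof -
  obtain d where d: "d > 0" and box: "{s - d..s + d} \<times> {t - d..t + d} \<subseteq> W"
    using open_contains_rectangle[OF W] .
  have in_W: "(\<sigma>, \<tau>) \<in> W" if "\<sigma> \<in> {s - d..s + d}" "\<tau> \<in> {t - d..t + d}" for \<sigma> \<tau>
    using box that by auto
  have incr: "(\<lambda>u. f1 u \<tau>) integrable_on {s - d..\<sigma>}"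
      "integral {s - d..\<sigma>} (\<lambda>u. f1 u \<tau>) = f \<sigma> \<tau> - f (s - d) \<tau>"
    if "\<sigma> \<in> {s - d..s + d}" "\<tau> \<in> {t - d..t + d}" for \<sigma> \<tau>
  proof -
    have "((\<lambda>u. f1 u \<tau>) has_integral f \<sigma> \<tau> - f (s - d) \<tau>) {s - d..\<sigma>}"
      using that
      by (intro fundamental_theorem_of_calculus)
        (auto simp: has_real_derivative_iff_has_vector_derivative[symmetric]
              intro!: DERIV_subset[OF f1[OF in_W]])
    then show "(\<lambda>u. f1 u \<tau>) integrable_on {s - d..\<sigma>}"
      "integral {s - d..\<sigma>} (\<lambda>u. f1 u \<tau>) = f \<sigma> \<tau> - f (s - d) \<tau>"
      by (auto simp: integrable_on_def integral_unique)
  qed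
  have interior: "at t within {t - d..t + d} = at t" "at s within {s - d..s + d} = at s"
    using d by (simp_all add: at_within_Icc_at)
  \<comment> \<open>This exhibits \<open>f2 \<sigma> t\<close>, up to a constant, as an integral with upper limit \<open>\<sigma>\<close> and continuous
    integrand, hence as differentiable in \<open>\<sigma>\<close>.\<close>
  have f2_eq: "f2 (s - d) t + integral {s - d..\<sigma>} (\<lambda>u. f12 u t) = f2 \<sigma> t"
    if \<sigma>: "\<sigma> \<in> {s - d..s + d}" for \<sigma>
  proof -
    have leibniz: "((\<lambda>\<tau>. integral (cbox (s - d) \<sigma>) (\<lambda>u. f1 u \<tau>)) has_vector_derivative
            integral (cbox (s - d) \<sigma>) (\<lambda>u. f12 u t)) (at t within {t - d..t + d})"
    proof (rule leibniz_rule_vector_derivative[where f = "\<lambda>\<tau> u. f1 u \<tau>" and fx = "\<lambda>\<tau> u. f12 u \<tau>"])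
      show "((\<lambda>\<tau>. f1 u \<tau>) has_vector_derivative f12 u \<tau>) (at \<tau> within {t - d..t + d})"
        if "\<tau> \<in> {t - d..t + d}" "u \<in> cbox (s - d) \<sigma>" for \<tau> u
        using f12[OF in_W, of u \<tau>] that \<sigma>
        by (auto simp: has_real_derivative_iff_has_vector_derivative
              intro: has_vector_derivative_at_within)
      show "continuous_on ({t - d..t + d} \<times> cbox (s - d) \<sigma>) (\<lambda>(\<tau>, u). f12 u \<tau>)"
        unfolding split_beta
        using \<sigma> by (intro continuous_on_compose2[OF cont[unfolded split_beta], of _ "\<lambda>p. (snd p, fst p)", simplified]
              continuous_intros) (auto intro!: in_W)
    qed (use incr \<sigma> d in auto)
    have "((\<lambda>\<tau>. f \<sigma> \<tau> - f (s - d) \<tau>) has_vector_derivative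
            integral {s - d..\<sigma>} (\<lambda>u. f12 u t)) (at t within {t - d..t + d})"
      by (rule has_vector_derivative_transform[OF _ _ leibniz[unfolded box_real]])
        (use d incr \<sigma> in auto)
    moreover have "((\<lambda>\<tau>. f \<sigma> \<tau> - f (s - d) \<tau>) has_vector_derivative f2 \<sigma> t - f2 (s - d) t) (at t)"
      unfolding has_real_derivative_iff_has_vector_derivative[symmetric]
      using \<sigma> d by (intro derivative_intros f2 in_W) auto
    ultimately show ?thesis
      unfolding interior by (auto dest: vector_derivative_unique_at)
  qed
  have "continuous_on {s - d..s + d} (\<lambda>u. f12 u t)"
    using d by (intro continuous_on_compose2[OF cont[unfolded split_beta], of _ "\<lambda>u. (u, t)", simplified]
              continuous_intros) (auto intro!: in_W)
  then have "((\<lambda>\<sigma>. f2 (s - d) t + integral {s - d..\<sigma>} (\<lambda>u. f12 u t)) has_real_derivative 0 + f12 s t)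
      (at s within {s - d..s + d})"
    using d by (intro derivative_intros integral_has_real_derivative) auto
  then have "((\<lambda>\<sigma>. f2 \<sigma> t) has_real_derivative 0 + f12 s t) (at s within {s - d..s + d})"
    by (rule has_field_derivative_transform_within[where d = 1]) (use d f2_eq in auto)
  then show ?thesis
    by (simp add: interior)
qed

text \<open>A plane Poincare lemma for the form \<open>a ds - b dt\<close>, which is closed because the \<open>t\<close>-derivative of
\<open>a\<close> is minus the \<open>s\<close>-derivative of \<open>b\<close>. The hypotheses on \<open>V\<close> make every point reachable from the base
point \<open>(M, t0)\<close> by going up a column and then left along a row. This suits a domain that, like
\<open>Omega c\<close>, is cut by a diagonal on its lower left side. Restricting to \<open>s < M\<close> and \<open>t0 < t\<close> avoids
integrals with reversed limits.\<close>

lemma closed_field_has_potential: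
  fixes a b m :: "real \<Rightarrow> real \<Rightarrow> real"
  assumes V: "open V"
    and right: "\<And>s t \<sigma>. (s, t) \<in> V \<Longrightarrow> s \<le> \<sigma> \<Longrightarrow> (\<sigma>, t) \<in> V"
    and column: "\<And>\<tau>. t0 \<le> \<tau> \<Longrightarrow> (M, \<tau>) \<in> V"
    and a: "continuous_on V (\<lambda>(s, t). a s t)"
    and b: "continuous_on V (\<lambda>(s, t). b s t)"
    and m: "continuous_on V (\<lambda>(s, t). m s t)"
    and at: "\<And>s t. (s, t) \<in> V \<Longrightarrow> ((\<lambda>\<tau>. a s \<tau>) has_real_derivative m s t) (at t)"
    and bs: "\<And>s t. (s, t) \<in> V \<Longrightarrow> ((\<lambda>\<sigma>. b \<sigma> t) has_real_derivative - m s t) (at s)"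
  obtains \<phi> where "\<And>s t. (s, t) \<in> V \<Longrightarrow> s < M \<Longrightarrow> t0 < t \<Longrightarrow>
    (\<phi> has_derivative (\<lambda>(u, v). a s t * u - b s t * v)) (at (s, t))"
proof
  note cont = a[unfolded split_beta, THEN continuous_on_compose2]
    b[unfolded split_beta, THEN continuous_on_compose2]
    m[unfolded split_beta, THEN continuous_on_compose2]
  \<comment> \<open>Minus the integral along the path from \<open>(s, t)\<close> right to \<open>(M, t)\<close> and then down to \<open>(M, t0)\<close>.\<close>
  define \<psi> where "\<psi> s t = - integral {s..M} (\<lambda>\<sigma>. a \<sigma> t) - integral {t0..t} (\<lambda>\<tau>. b M \<tau>)" for s t
  fix s t assume st: "(s, t) \<in> V" "s < M" "t0 < t"
  have "open (V \<inter> {..<M} \<times> {t0<..})"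
    by (intro open_Int V open_Times) auto
  then obtain d where d: "d > 0" and "{s - d..s + d} \<times> {t - d..t + d} \<subseteq> V \<inter> {..<M} \<times> {t0<..}"
    using st open_contains_rectangle[of "V \<inter> {..<M} \<times> {t0<..}" s t] by auto
  then have box: "(\<sigma>, \<tau>) \<in> V" "\<sigma> < M" "t0 < \<tau>"
    if "\<sigma> \<in> {s - d..s + d}" "\<tau> \<in> {t - d..t + d}" for \<sigma> \<tau>
    using that by (blast, auto simp: subset_iff)
  let ?X = "{s - d..s + d}" and ?Y = "{t - d..t + d}"
  have \<psi>_s: "((\<lambda>\<sigma>. \<psi> \<sigma> t) has_real_derivative a s t) (at s within ?X)"
  proof -
    have "((\<lambda>\<sigma>. integral {\<sigma>..M} (\<lambda>\<sigma>. a \<sigma> t)) has_real_derivative - a s t) (at s within {s - d..M})"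
      using d st box(1)[of "s - d" t]
      by (intro integral_has_real_derivative' cont(1)[of _ "\<lambda>u. (u, t)", simplified] continuous_intros)
        (auto intro!: right[of "s - d" t])
    then have "((\<lambda>\<sigma>. \<psi> \<sigma> t) has_real_derivative - (- a s t) - 0) (at s within {s - d..M})"
      unfolding \<psi>_def by (intro derivative_intros) auto
    then show ?thesis
      by (rule DERIV_subset[THEN DERIV_cong])
        (use box(2)[of "s + d" t] d in auto)
  qed
  have \<psi>_t: "((\<lambda>\<tau>. \<psi> \<sigma> \<tau>) has_real_derivative - b \<sigma> \<tau>) (at \<tau> within ?Y)"
    if \<sigma>: "\<sigma> \<in> ?X" and \<tau>: "\<tau> \<in> ?Y" for \<sigma> \<tau>
  proof -
    have row: "(u, v) \<in> V" if "u \<in> {\<sigma>..M}" "v \<in> ?Y" for u v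
      using right[of \<sigma> v u] box(1)[of \<sigma> v] \<sigma> that by auto
    have "((\<lambda>\<tau>. integral (cbox \<sigma> M) (\<lambda>u. a u \<tau>)) has_vector_derivative
            integral (cbox \<sigma> M) (\<lambda>u. m u \<tau>)) (at \<tau> within ?Y)"
    proof (rule leibniz_rule_vector_derivative[where f = "\<lambda>\<tau> u. a u \<tau>" and fx = "\<lambda>\<tau> u. m u \<tau>"])
      show "((\<lambda>\<tau>. a u \<tau>) has_vector_derivative m u \<tau>) (at \<tau> within ?Y)"
        if "\<tau> \<in> ?Y" "u \<in> cbox \<sigma> M" for \<tau> u
        using at[OF row, of u \<tau>] that
        by (auto simp: has_real_derivative_iff_has_vector_derivative
              intro: has_vector_derivative_at_within)
      show "continuous_on (?Y \<times> cbox \<sigma> M) (\<lambda>(\<tau>, u). m u \<tau>)"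
        unfolding split_beta
        by (intro cont(3)[of _ "\<lambda>p. (snd p, fst p)", simplified] continuous_intros)
          (auto intro!: row)
      show "(\<lambda>u. a u \<tau>) integrable_on cbox \<sigma> M" if "\<tau> \<in> ?Y" for \<tau>
        using that
        by (intro integrable_continuous cont(1)[of _ "\<lambda>u. (u, \<tau>)", simplified] continuous_intros)
          (auto intro!: row)
    qed (use \<tau> in auto)
    \<comment> \<open>Closedness enters here: the \<open>\<tau>\<close>-derivative of the row integral is a boundary term of \<open>b\<close>.\<close>
    moreover have "integral {\<sigma>..M} (\<lambda>u. m u \<tau>) = b \<sigma> \<tau> - b M \<tau>"
    proof -
      have "((\<lambda>u. - m u \<tau>) has_integral b M \<tau> - b \<sigma> \<tau>) {\<sigma>..M}"
        using box(2)[of \<sigma> \<tau>] \<sigma> \<tau>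
        by (intro fundamental_theorem_of_calculus)
          (auto simp: has_real_derivative_iff_has_vector_derivative[symmetric]
                intro!: DERIV_subset[OF bs[OF row]])
      then show ?thesis
        by (simp add: has_integral_neg_iff integral_unique)
    qed
    ultimately have I1: "((\<lambda>\<tau>. integral {\<sigma>..M} (\<lambda>u. a u \<tau>)) has_real_derivative b \<sigma> \<tau> - b M \<tau>)
        (at \<tau> within ?Y)"
      by (simp add: has_real_derivative_iff_has_vector_derivative)
    have "((\<lambda>\<tau>. integral {t0..\<tau>} (\<lambda>\<tau>. b M \<tau>)) has_real_derivative b M \<tau>) (at \<tau> within {t0..t + d})"
      using \<tau> box(3)[of \<sigma> \<tau>] \<sigma>
      by (intro integral_has_real_derivative cont(2)[of _ "\<lambda>u. (M, u)", simplified] continuous_intros)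
        (auto intro!: column)
    then have I2: "((\<lambda>\<tau>. integral {t0..\<tau>} (\<lambda>\<tau>. b M \<tau>)) has_real_derivative b M \<tau>) (at \<tau> within ?Y)"
      by (rule DERIV_subset) (use box(3)[of s "t - d"] d in auto)
    show ?thesis
      unfolding \<psi>_def
      by (rule DERIV_cong[OF DERIV_diff[OF DERIV_minus[OF I1] I2]]) simp
  qed
  \<comment> \<open>The partials alone do not suffice for integrating along the diagonal part of the boundary,
    so the total derivative is needed.\<close>
  have "((\<lambda>(s, t). \<psi> s t) has_derivative (\<lambda>(u, v). a s t * u + ((- b s t) *\<^sub>R id_blinfun) v))
      (at (s, t) within ?X \<times> ?Y)"
  proof (rule has_derivative_partialsI)
    show "((\<lambda>\<sigma>. \<psi> \<sigma> t) has_derivative (\<lambda>u. a s t * u)) (at s within ?X)"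
      using \<psi>_s by (simp add: has_field_derivative_def)
    show "((\<lambda>\<tau>. \<psi> \<sigma> \<tau>) has_derivative ((- b \<sigma> \<tau>) *\<^sub>R id_blinfun)) (at \<tau> within ?Y)"
      if "\<sigma> \<in> ?X" "\<tau> \<in> ?Y" for \<sigma> \<tau>
    proof -
      have "blinfun_apply ((- b \<sigma> \<tau>) *\<^sub>R id_blinfun) = (*) (- b \<sigma> \<tau>)"
        by (auto simp: fun_eq_iff blinfun.bilinear_simps)
      then show ?thesis
        using \<psi>_t[OF that] by (simp only: has_field_derivative_def)
    qed
    have "continuous_on (?X \<times> ?Y) (\<lambda>p. (- b (fst p) (snd p)) *\<^sub>R (id_blinfun :: real \<Rightarrow>\<^sub>L real))"
      by (intro continuous_intros cont(2)[of _ "\<lambda>p. p", simplified]) (auto intro: box)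
    then show "continuous (at (s, t) within ?X \<times> ?Y)
        (\<lambda>(s, t). (- b s t) *\<^sub>R (id_blinfun :: real \<Rightarrow>\<^sub>L real))"
      using d by (auto simp: continuous_on_eq_continuous_within case_prod_unfold)
  qed (use d in auto)
  moreover have "at (s, t) within ?X \<times> ?Y = at (s, t)"
    using d by (intro at_within_interior) (auto simp: interior_Times)
  ultimately show "((\<lambda>(s, t). \<psi> s t) has_derivative (\<lambda>(u, v). a s t * u - b s t * v)) (at (s, t))"
    by (simp add: blinfun.bilinear_simps)
qed

lemma potential_integral_along_line:
  fixes \<phi> :: "real \<times> real \<Rightarrow> real"
  assumes "u \<le> v"
    and \<phi>: "\<And>r. r \<in> {u..v} \<Longrightarrow>
      (\<phi> has_derivative (\<lambda>(h, k). a (\<alpha> + p * r) (\<beta> + q * r) * h - b (\<alpha> + p * r) (\<beta> + q * r) * k))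
        (at (\<alpha> + p * r, \<beta> + q * r))"
  shows "((\<lambda>r. p * a (\<alpha> + p * r) (\<beta> + q * r) - q * b (\<alpha> + p * r) (\<beta> + q * r)) has_integral
    \<phi> (\<alpha> + p * v, \<beta> + q * v) - \<phi> (\<alpha> + p * u, \<beta> + q * u)) {u..v}"
proof (rule fundamental_theorem_of_calculus[OF assms(1)])
  fix r assume r: "r \<in> {u..v}"
  have "((\<lambda>r. (\<alpha> + p * r, \<beta> + q * r)) has_derivative (\<lambda>h. (p * h, q * h))) (at r within {u..v})"
    by (auto intro!: derivative_eq_intros)
  from has_derivative_compose[OF this \<phi>[OF r]]
  show "((\<lambda>r. \<phi> (\<alpha> + p * r, \<beta> + q * r)) has_vector_derivative
      p * a (\<alpha> + p * r) (\<beta> + q * r) - q * b (\<alpha> + p * r) (\<beta> + q * r)) (at r within {u..v})"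
    by (simp add: has_vector_derivative_def algebra_simps)
qed

section \<open>The relation between characteristics and boundary\<close>

text \<open>The common shape of the integral relations. Put \<open>p = pos_part (c - t)\<close> and \<open>q = pos_part (c - s)\<close>. The
characteristics through \<open>(s, t)\<close> meet the boundary of the domain in \<open>(p, t)\<close> and \<open>(s, q)\<close>, and the
relation says that the line integrals of \<open>a d\<sigma> - b d\<tau>\<close> from \<open>(p, t)\<close> to \<open>(s, q)\<close> along the
characteristics and along the boundary agree. On the boundary side the path consists of a piece of
the \<open>t\<close>-axis, of the diagonal \<open>\<sigma> + \<tau> = c\<close> and of the \<open>s\<close>-axis.\<close>

definition characteristic_relation ::
  "real \<Rightarrow> (real \<Rightarrow> real \<Rightarrow> real) \<Rightarrow> (real \<Rightarrow> real \<Rightarrow> real) \<Rightarrow> real \<Rightarrow> real \<Rightarrow> bool" where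
  "characteristic_relation c a b s t \<longleftrightarrow>
     integral {pos_part (c - t)..s} (\<lambda>\<sigma>. a \<sigma> t) + integral {pos_part (c - s)..t} (\<lambda>\<tau>. b s \<tau>) =
     integral {pos_part (c - t)..min c s} (\<lambda>\<sigma>. a \<sigma> (c - \<sigma>) + b \<sigma> (c - \<sigma>))
     + integral {min c s..s} (\<lambda>\<sigma>. a \<sigma> (pos_part (c - s)))
     + integral {min c t..t} (\<lambda>\<tau>. b (pos_part (c - t)) \<tau>)"

text \<open>With a potential both line integrals are the difference of its values at the common end
points.\<close>

lemma characteristic_relation_of_potential:
  fixes \<phi> :: "real \<times> real \<Rightarrow> real"
  assumes "c > 0" and st: "(s, t) \<in> Omega_bar c"
    and \<phi>: "\<And>\<sigma> \<tau>. (\<sigma>, \<tau>) \<in> Omega_bar c \<Longrightarrow> \<sigma> \<le> s \<Longrightarrow>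
      (\<phi> has_derivative (\<lambda>(h, k). a \<sigma> \<tau> * h - b \<sigma> \<tau> * k)) (at (\<sigma>, \<tau>))"
  shows "characteristic_relation c a b s t"
proof -
  let ?p = "pos_part (c - t)" and ?q = "pos_part (c - s)"
  have horizontal: "integral {u..v} (\<lambda>\<sigma>. a \<sigma> \<tau>) = \<phi> (v, \<tau>) - \<phi> (u, \<tau>)"
    if "u \<le> v" "v \<le> s" "(u, \<tau>) \<in> Omega_bar c" for u v \<tau>
    by (rule potential_integral_along_line[of u v \<phi> a 0 1 \<tau> 0 b, simplified, THEN integral_unique])
      (use that in \<open>auto simp: Omega_bar_def intro!: \<phi>\<close>)
  have vertical: "integral {u..v} (\<lambda>\<tau>. b \<sigma> \<tau>) = \<phi> (\<sigma>, u) - \<phi> (\<sigma>, v)"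
    if "u \<le> v" "\<sigma> \<le> s" "(\<sigma>, u) \<in> Omega_bar c" for u v \<sigma>
  proof -
    have "integral {u..v} (\<lambda>\<tau>. - b \<sigma> \<tau>) = \<phi> (\<sigma>, v) - \<phi> (\<sigma>, u)"
      by (rule potential_integral_along_line[of u v \<phi> a \<sigma> 0 0 1 b, simplified, THEN integral_unique])
        (use that in \<open>auto simp: Omega_bar_def intro!: \<phi>\<close>)
    then show ?thesis
      by simp
  qed
  have diagonal: "integral {u..v} (\<lambda>\<sigma>. a \<sigma> (c - \<sigma>) + b \<sigma> (c - \<sigma>)) = \<phi> (v, c - v) - \<phi> (u, c - u)"
    if "u \<le> v" "0 \<le> u" "v \<le> c" "v \<le> s" for u v
    by (rule potential_integral_along_line[of u v \<phi> a 0 1 c "-1" b, simplified, THEN integral_unique])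
      (use that in \<open>auto simp: Omega_bar_def intro!: \<phi>\<close>)
  \<comment> \<open>The five segments are \<open>(?p, t) -> (s, t) -> (s, ?q)\<close> and
    \<open>(?p, t) -> (?p, min c t) -> (min c s, ?q) -> (s, ?q)\<close>, some of which may be points.\<close>
  have ends: "c - ?p = min c t" "c - min c s = ?q" "?p \<le> s" "?q \<le> t" "?p \<le> min c s"
      "(?p, t) \<in> Omega_bar c" "(s, ?q) \<in> Omega_bar c" "(min c s, ?q) \<in> Omega_bar c"
      "(?p, min c t) \<in> Omega_bar c"
    using st \<open>c > 0\<close> by (auto simp: Omega_bar_def)
  have bounds: "0 \<le> ?p" "min c s \<le> c" "min c s \<le> s" "min c t \<le> t"
    by auto
  show ?thesis
    unfolding characteristic_relation_def
      horizontal[OF ends(3) order_refl ends(6)] vertical[OF ends(4) order_refl ends(7)]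
      diagonal[OF ends(5) bounds(1-3)] horizontal[OF bounds(3) order_refl ends(8)]
      vertical[OF bounds(4) ends(3,9)] ends(1,2)
    by linarith
qed

lemma continuous_on_eq_zero_at_left_end:
  fixes G :: "real \<Rightarrow> real"
  assumes "continuous_on {p..q} G" and "p < q" and zero: "\<And>r. r \<in> {p<..q} \<Longrightarrow> G r = 0"
  shows "G p = 0"
proof -
  have "(G \<longlongrightarrow> G p) (at_right p)"
    using assms(1,2) by (simp add: continuous_on_Icc_at_rightD)
  moreover have "\<forall>\<^sub>F r in at_right p. G r = 0"
    using assms(2) zero by (auto simp: eventually_at_right intro!: exI[of _ q])
  then have "(G \<longlongrightarrow> 0) (at_right p)"
    by (rule tendsto_eventually)
  ultimately show ?thesis
    using tendsto_unique trivial_limit_at_right_real by blast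
qed

text \<open>The intervals of integration are fixed, and moving a point of the closed domain by \<open>(e, e)\<close> keeps it
in the domain; so the integral depends continuously on \<open>e\<close>, also at \<open>e = 0\<close>.\<close>

lemma continuous_on_integral_shifted:
  fixes f :: "real \<Rightarrow> real \<Rightarrow> real" and \<gamma> \<delta> :: "real \<Rightarrow> real"
  assumes f: "continuous_on (Omega_bar c) (\<lambda>(s, t). f s t)"
    and [continuous_intros]: "continuous_on {p..q} \<gamma>" "continuous_on {p..q} \<delta>"
    and in_dom: "\<And>r. r \<in> {p..q} \<Longrightarrow> (\<gamma> r, \<delta> r) \<in> Omega_bar c"
  shows "continuous_on {0..1} (\<lambda>e. integral {p..q} (\<lambda>r. f (\<gamma> r + e) (\<delta> r + e)))"
proof -
  have "continuous_on ({0..1} \<times> {p..q}) (\<lambda>z. (\<gamma> (snd z) + fst z, \<delta> (snd z) + fst z))"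
    by (intro continuous_intros continuous_on_compose2[OF assms(2) continuous_on_snd]
        continuous_on_compose2[OF assms(3) continuous_on_snd]) auto
  then have "continuous_on ({0..1} \<times> cbox p q) (\<lambda>(e, r). f (\<gamma> r + e) (\<delta> r + e))"
    using in_dom unfolding case_prod_unfold
    by (intro continuous_on_compose2[OF f[unfolded case_prod_unfold],
          of _ "\<lambda>z. (\<gamma> (snd z) + fst z, \<delta> (snd z) + fst z)", simplified])
      (fastforce simp: Omega_bar_def)+
  then show ?thesis
    using integral_continuous_on_param[of "{0..1}" p q "\<lambda>e r. f (\<gamma> r + e) (\<delta> r + e)"] by simp
qed

text \<open>The fields of a classical solution are differentiable in the open domain but only continuous up to
its boundary. For \<open>e > 0\<close> the translated fields take values from the open domain alone, where closed
fields have a potential, and the integrals in the relation are continuous in \<open>e\<close>.\<close>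

lemma characteristic_relation_limit:
  assumes "c > 0" and st: "(s, t) \<in> Omega_bar c"
    and a: "continuous_on (Omega_bar c) (\<lambda>(s, t). a s t)"
    and b: "continuous_on (Omega_bar c) (\<lambda>(s, t). b s t)"
    and shifted: "\<And>e. 0 < e \<Longrightarrow>
      characteristic_relation c (\<lambda>\<sigma> \<tau>. a (\<sigma> + e) (\<tau> + e)) (\<lambda>\<sigma> \<tau>. b (\<sigma> + e) (\<tau> + e)) s t"
  shows "characteristic_relation c a b s t"
proof -
  let ?p = "pos_part (c - t)" and ?q = "pos_part (c - s)"
  define G where "G e =
    integral {?p..s} (\<lambda>\<sigma>. a (\<sigma> + e) (t + e)) + integral {?q..t} (\<lambda>\<tau>. b (s + e) (\<tau> + e)) -
     (integral {?p..min c s} (\<lambda>\<sigma>. a (\<sigma> + e) ((c - \<sigma>) + e) + b (\<sigma> + e) ((c - \<sigma>) + e))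
     + integral {min c s..s} (\<lambda>\<sigma>. a (\<sigma> + e) (?q + e))
     + integral {min c t..t} (\<lambda>\<tau>. b (?p + e) (\<tau> + e)))" for e
  have ab: "continuous_on (Omega_bar c) (\<lambda>(s, t). a s t + b s t)"
    using continuous_on_add[OF a b] by (simp add: case_prod_unfold)
  have "continuous_on {0..1} G"
    unfolding G_def using st \<open>c > 0\<close>
    by (intro continuous_on_add continuous_on_diff
        continuous_on_integral_shifted[OF a] continuous_on_integral_shifted[OF b]
        continuous_on_integral_shifted[OF ab] continuous_on_id continuous_on_const)
      (auto simp: Omega_bar_def)
  moreover have "G e = 0" if "e \<in> {0<..1}" for e
    using shifted[of e] that by (simp add: G_def characteristic_relation_def)
  ultimately have "G 0 = 0"
    by (intro continuous_on_eq_zero_at_left_end[of 0 1 G]) auto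
  then show ?thesis
    by (simp add: G_def characteristic_relation_def)
qed

section \<open>The four ranges of the integral relations\<close>

text \<open>The next four lemmas evaluate the truncations in the four parts into which the lines \<open>s = c\<close> and
\<open>t = c\<close> divide the domain. The parts are taken closed, since both formulas are needed on a
separating line.\<close>

lemma characteristic_relation_above:
  assumes "0 \<le> s" "s \<le> c" "c \<le> t"
  shows "characteristic_relation c a b s t \<longleftrightarrow>
    integral {0..s} (\<lambda>\<sigma>. a \<sigma> t) + integral {c - s..t} (\<lambda>\<tau>. b s \<tau>) =
    integral {0..s} (\<lambda>\<sigma>. a \<sigma> (c - \<sigma>) + b \<sigma> (c - \<sigma>)) + integral {c..t} (\<lambda>\<tau>. b 0 \<tau>)"
  using assms by (auto simp: characteristic_relation_def max_absorb1 max_absorb2 min_absorb1 min_absorb2)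

lemma characteristic_relation_right:
  assumes "0 \<le> t" "t \<le> c" "c \<le> s"
  shows "characteristic_relation c a b s t \<longleftrightarrow>
    integral {c - t..s} (\<lambda>\<sigma>. a \<sigma> t) + integral {0..t} (\<lambda>\<tau>. b s \<tau>) =
    integral {c - t..c} (\<lambda>\<sigma>. a \<sigma> (c - \<sigma>) + b \<sigma> (c - \<sigma>)) + integral {c..s} (\<lambda>\<sigma>. a \<sigma> 0)"
  using assms by (auto simp: characteristic_relation_def max_absorb1 max_absorb2 min_absorb1 min_absorb2)

lemma characteristic_relation_corner:
  assumes "c \<le> s" "c \<le> t"
  shows "characteristic_relation c a b s t \<longleftrightarrow>
    integral {0..s} (\<lambda>\<sigma>. a \<sigma> t) + integral {0..t} (\<lambda>\<tau>. b s \<tau>) =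
    integral {0..c} (\<lambda>\<sigma>. a \<sigma> (c - \<sigma>) + b \<sigma> (c - \<sigma>)) + integral {c..s} (\<lambda>\<sigma>. a \<sigma> 0)
    + integral {c..t} (\<lambda>\<tau>. b 0 \<tau>)"
  using assms by (auto simp: characteristic_relation_def max_absorb1 max_absorb2 min_absorb1 min_absorb2)

lemma characteristic_relation_triangle:
  assumes "s \<le> c" "t \<le> c"
  shows "characteristic_relation c a b s t \<longleftrightarrow>
    integral {c - t..s} (\<lambda>\<sigma>. a \<sigma> t) + integral {c - s..t} (\<lambda>\<tau>. b s \<tau>) =
    integral {c - t..s} (\<lambda>\<sigma>. a \<sigma> (c - \<sigma>) + b \<sigma> (c - \<sigma>))"
  using assms by (auto simp: characteristic_relation_def max_absorb1 max_absorb2 min_absorb1 min_absorb2)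

lemma integral_reflect_about:
  fixes f :: "real \<Rightarrow> real"
  shows "integral {0..t} (\<lambda>\<tau>. f (c - \<tau>)) = integral {c - t..c} f"
proof -
  have "integral {0..t} (\<lambda>\<tau>. f (c - \<tau>)) = integral {- t..0} (\<lambda>\<sigma>. f (c + \<sigma>))"
    using Henstock_Kurzweil_Integration.integral_reflect_real[of 0 "-t" "\<lambda>\<sigma>. f (c + \<sigma>)"] by simp
  also have "\<dots> = integral {c - t..c} f"
    using integral_shift_real_ivl[of "c - t" c c f] by (simp add: add.commute)
  finally show ?thesis .
qed

lemma continuous_on_integral_param_Omega_bar:
  fixes f :: "real \<Rightarrow> real \<Rightarrow> real"
  assumes f: "continuous_on (Omega_bar c) (\<lambda>(s, t). f s t)" and "0 \<le> p" "c \<le> p + r0" "0 \<le> r0"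
  shows "continuous_on {r0..r1} (\<lambda>r. integral {p..q} (\<lambda>\<sigma>. f \<sigma> r))"
    and "continuous_on {r0..r1} (\<lambda>r. integral {p..q} (\<lambda>\<tau>. f r \<tau>))"
proof -
  note f' = continuous_on_compose2[OF f[unfolded case_prod_unfold]]
  have "continuous_on ({r0..r1} \<times> cbox p q) (\<lambda>(r, \<sigma>). f \<sigma> r)"
    using assms(2-) unfolding case_prod_unfold
    by (intro f'[of _ "\<lambda>z. (snd z, fst z)", simplified] continuous_intros) (auto simp: Omega_bar_def)
  then show "continuous_on {r0..r1} (\<lambda>r. integral {p..q} (\<lambda>\<sigma>. f \<sigma> r))"
    using integral_continuous_on_param[of "{r0..r1}" p q "\<lambda>r \<sigma>. f \<sigma> r"] by simp
  have "continuous_on ({r0..r1} \<times> cbox p q) (\<lambda>(r, \<tau>). f r \<tau>)"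
    using assms(2-) unfolding case_prod_unfold
    by (intro f'[of _ "\<lambda>z. z", simplified] continuous_intros) (auto simp: Omega_bar_def)
  then show "continuous_on {r0..r1} (\<lambda>r. integral {p..q} (\<lambda>\<tau>. f r \<tau>))"
    using integral_continuous_on_param[of "{r0..r1}" p q "\<lambda>r \<tau>. f r \<tau>"] by simp
qed

lemma continuous_on_indefinite_integral_from:
  fixes f :: "real \<Rightarrow> real"
  assumes "continuous_on {p..} f" "p \<le> q"
  shows "continuous_on {q..r} (\<lambda>u. integral {p..u} f)"
proof -
  have "f integrable_on {p..r}"
    by (intro integrable_continuous_real continuous_on_subset[OF assms(1)]) auto
  then have "continuous_on {p..r} (\<lambda>u. integral {p..u} f)"
    by (rule indefinite_integral_continuous_1)
  then show ?thesis
    by (rule continuous_on_subset) (use assms(2) in auto)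
qed

text \<open>The relation extends by continuity to the lines \<open>t = c\<close> and \<open>s = c\<close>. Approaching them from
\<open>t > c\<close> and \<open>s > c\<close> is convenient because there the lower limits of all integrals are constant.\<close>

lemma characteristic_relation_closure:
  assumes c: "c > 0"
    and a: "continuous_on (Omega_bar c) (\<lambda>(s, t). a s t)"
    and b: "continuous_on (Omega_bar c) (\<lambda>(s, t). b s t)"
  shows "0 \<le> s \<Longrightarrow> s \<le> c \<Longrightarrow> (\<And>t. c < t \<Longrightarrow> characteristic_relation c a b s t) \<Longrightarrow>
      characteristic_relation c a b s c"
    and "0 \<le> t \<Longrightarrow> t \<le> c \<Longrightarrow> (\<And>s. c < s \<Longrightarrow> characteristic_relation c a b s t) \<Longrightarrow>
      characteristic_relation c a b c t"
proof -
  note a' = continuous_on_compose2[OF a[unfolded case_prod_unfold]]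
    and b' = continuous_on_compose2[OF b[unfolded case_prod_unfold]]
  have b_col: "continuous_on {c - s..} (\<lambda>\<tau>. b s \<tau>)" if "0 \<le> s" "s \<le> c" for s
    using that by (intro b'[of _ "\<lambda>\<tau>. (s, \<tau>)", simplified] continuous_intros) (auto simp: Omega_bar_def)
  have a_row: "continuous_on {c - t..} (\<lambda>\<sigma>. a \<sigma> t)" if "0 \<le> t" "t \<le> c" for t
    using that by (intro a'[of _ "\<lambda>\<sigma>. (\<sigma>, t)", simplified] continuous_intros) (auto simp: Omega_bar_def)
  show "characteristic_relation c a b s c"
    if s: "0 \<le> s" "s \<le> c" and above: "\<And>t. c < t \<Longrightarrow> characteristic_relation c a b s t"
  proof -
    define G where "G t =
      integral {0..s} (\<lambda>\<sigma>. a \<sigma> t) + integral {c - s..t} (\<lambda>\<tau>. b s \<tau>) -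
      (integral {0..s} (\<lambda>\<sigma>. a \<sigma> (c - \<sigma>) + b \<sigma> (c - \<sigma>)) + integral {c..t} (\<lambda>\<tau>. b 0 \<tau>))" for t
    have "continuous_on {c..c + 1} G"
      unfolding G_def using s c b_col[of 0]
      by (intro continuous_on_add continuous_on_diff continuous_on_const
          continuous_on_integral_param_Omega_bar(1)[OF a]
          continuous_on_indefinite_integral_from b_col) auto
    moreover have "G t = 0" if "t \<in> {c<..c + 1}" for t
      using above[of t] that s by (simp add: G_def characteristic_relation_above)
    ultimately have "G c = 0"
      by (intro continuous_on_eq_zero_at_left_end[of c "c + 1" G]) auto
    then show ?thesis
      using s by (simp add: G_def characteristic_relation_above)
  qed
  show "characteristic_relation c a b c t"
    if t: "0 \<le> t" "t \<le> c" and right: "\<And>s. c < s \<Longrightarrow> characteristic_relation c a b s t"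
  proof -
    define G where "G s =
      integral {c - t..s} (\<lambda>\<sigma>. a \<sigma> t) + integral {0..t} (\<lambda>\<tau>. b s \<tau>) -
      (integral {c - t..c} (\<lambda>\<sigma>. a \<sigma> (c - \<sigma>) + b \<sigma> (c - \<sigma>)) + integral {c..s} (\<lambda>\<sigma>. a \<sigma> 0))" for s
    have "continuous_on {c..c + 1} G"
      unfolding G_def using t c a_row[of 0]
      by (intro continuous_on_add continuous_on_diff continuous_on_const
          continuous_on_integral_param_Omega_bar(2)[OF b]
          continuous_on_indefinite_integral_from a_row) auto
    moreover have "G s = 0" if "s \<in> {c<..c + 1}" for s
      using right[of s] that t by (simp add: G_def characteristic_relation_right)
    ultimately have "G c = 0"
      by (intro continuous_on_eq_zero_at_left_end[of c "c + 1" G]) auto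
    then show ?thesis
      using t by (simp add: G_def characteristic_relation_right)
  qed
qed

abbreviation weighted_Ds where
  "weighted_Ds c l x \<equiv> (\<lambda>s t. l (s + t) * Ds (Omega_bar c) x s t)"

abbreviation weighted_Dt where
  "weighted_Dt c l x \<equiv> (\<lambda>s t. l (s + t) * Dt (Omega_bar c) x s t)"

lemma continuous_on_weighted:
  assumes l: "continuous_on {c..} l" and f: "continuous_on (Omega_bar c) (\<lambda>(s, t). f s t)"
  shows "continuous_on (Omega_bar c) (\<lambda>(s, t). l (s + t) * f s t :: real)"
proof -
  have "continuous_on (Omega_bar c) (\<lambda>z. l (fst z + snd z))"
    by (intro continuous_on_compose2[OF l] continuous_intros) (auto simp: Omega_bar_def)
  then show ?thesis
    using f unfolding case_prod_unfold by (intro continuous_intros)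
qed

text \<open>The diagonal integrand is \<open>l c * n\<close>, so on its own range each of the four
relations is the characteristic relation. The ranges miss the lines \<open>t = c\<close> and \<open>s = c\<close>
in part, where continuity is used, and the diagonal, where the relation is trivial.\<close>

lemma integral_relations_iff_characteristic_relation:
  assumes c: "c > 0" and l: "continuous_on {c..} l" and x: "C1_on (Omega_bar c) x"
    and n: "\<And>s. s \<in> {0..c} \<Longrightarrow> Ds (Omega_bar c) x s (c - s) + Dt (Omega_bar c) x s (c - s) = n s"
  shows "integral_relations c l n x \<longleftrightarrow>
    (\<forall>(s, t) \<in> Omega_bar c. characteristic_relation c (weighted_Ds c l x) (weighted_Dt c l x) s t)"
    (is "_ \<longleftrightarrow> (\<forall>(s, t) \<in> _. ?R s t)")
proof -
  let ?a = "weighted_Ds c l x" and ?b = "weighted_Dt c l x"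
  have a: "continuous_on (Omega_bar c) (\<lambda>(s, t). ?a s t)"
    and b: "continuous_on (Omega_bar c) (\<lambda>(s, t). ?b s t)"
    using x by (intro continuous_on_weighted l; simp add: C1_on_def)+
  have diag: "integral {u..v} (\<lambda>\<sigma>. l c * Ds (Omega_bar c) x \<sigma> (c - \<sigma>) + l c * Dt (Omega_bar c) x \<sigma> (c - \<sigma>)) =
      l c * integral {u..v} n" if "0 \<le> u" "v \<le> c" for u v
  proof -
    have "integral {u..v} (\<lambda>\<sigma>. l c * Ds (Omega_bar c) x \<sigma> (c - \<sigma>) + l c * Dt (Omega_bar c) x \<sigma> (c - \<sigma>)) =
        integral {u..v} (\<lambda>\<sigma>. l c * n \<sigma>)"
      using that by (intro integral_cong) (simp add: n[symmetric] distrib_left)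
    then show ?thesis
      by simp
  qed
  have I: "relation_I c l n x \<longleftrightarrow> (\<forall>s t. s > c \<and> t > c \<longrightarrow> ?R s t)"
    using c by (auto simp: relation_I_def characteristic_relation_corner diag add_ac)
  have II: "relation_II c l n x \<longleftrightarrow> (\<forall>s t. 0 \<le> s \<and> s \<le> c \<and> t > c \<longrightarrow> ?R s t)"
    by (auto simp: relation_II_def characteristic_relation_above diag)
  have III: "relation_III c l n x \<longleftrightarrow> (\<forall>s t. s > c \<and> 0 \<le> t \<and> t \<le> c \<longrightarrow> ?R s t)"
    by (auto simp: relation_III_def characteristic_relation_right diag
        integral_reflect_about[of _ n])
  have IV: "relation_IV c l n x \<longleftrightarrow>
      (\<forall>s t. 0 < s \<and> s < c \<and> 0 < t \<and> t < c \<and> s + t > c \<longrightarrow> ?R s t)"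
    by (auto simp: relation_IV_def characteristic_relation_triangle diag)
  have "?R s t" if rel: "integral_relations c l n x" and st: "(s, t) \<in> Omega_bar c" for s t
  proof -
    note R = rel[unfolded integral_relations_def I II III IV]
    \<comment> \<open>The first and fourth cases are the four given ranges; the second and third are the lines
      between them; in the last one \<open>(s, t)\<close> is on the diagonal and all intervals are points.\<close>
    consider "c < s \<or> c < t" | "t = c" "s \<le> c" | "s = c" "t \<le> c"
      | "s < c" "t < c" "c < s + t" | "s \<le> c" "t \<le> c" "s + t = c"
      using st by (fastforce simp: Omega_bar_def)
    then show ?thesis
    proof cases
      case 1
      then show ?thesis
        using R st by (cases "c < s"; cases "c < t") (auto simp: Omega_bar_def)
    next
      case 2
      then show ?thesis
        using R st characteristic_relation_closure(1)[OF c a b, of s] by (auto simp: Omega_bar_def)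
    next
      case 3
      then show ?thesis
        using R st characteristic_relation_closure(2)[OF c a b, of t] by (auto simp: Omega_bar_def)
    next
      case 4
      then show ?thesis
        using R by auto
    next
      case 5
      then have "c - t = s" "c - s = t"
        by auto
      then show ?thesis
        using 5(1,2) by (simp only: characteristic_relation_triangle) simp
    qed
  qed
  moreover have "integral_relations c l n x" if "\<forall>(s, t) \<in> Omega_bar c. ?R s t"
    unfolding integral_relations_def I II III IV
    using that c by (auto simp: Omega_bar_def)
  ultimately show ?thesis
    by auto
qed

section \<open>Integration by parts\<close>

lemma C1_on_partials:
  assumes "C1_on S x" and "(s, t) \<in> S"
  shows "((\<lambda>\<sigma>. x \<sigma> t) has_real_derivative Ds S x s t) (at s within {\<sigma>. (\<sigma>, t) \<in> S})"
    and "((\<lambda>\<tau>. x s \<tau>) has_real_derivative Dt S x s t) (at t within {\<tau>. (s, \<tau>) \<in> S})"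
  using assms unfolding C1_on_def Ds_def Dt_def has_real_derivative_iff_has_vector_derivative
  by (auto simp: vector_derivative_works)

lemma integral_weighted_derivative:
  fixes w y :: "real \<Rightarrow> real"
  assumes "p \<le> q"
    and w: "\<And>r. r \<in> {p..q} \<Longrightarrow> (w has_real_derivative w' r) (at r within {p..q})"
    and y: "\<And>r. r \<in> {p..q} \<Longrightarrow> (y has_real_derivative y' r) (at r within {p..q})"
    and "continuous_on {p..q} w'" "continuous_on {p..q} y'"
  shows "integral {p..q} (\<lambda>r. w r * y' r) = w q * y q - w p * y p - integral {p..q} (\<lambda>r. w' r * y r)"
proof -
  have cont: "continuous_on {p..q} w" "continuous_on {p..q} y"
    using DERIV_continuous_on[OF w] DERIV_continuous_on[OF y] by auto
  have "((\<lambda>r. w' r * y r + w r * y' r) has_integral w q * y q - w p * y p) {p..q}"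
  proof (rule fundamental_theorem_of_calculus[OF assms(1)])
    show "((\<lambda>r. w r * y r) has_vector_derivative w' r * y r + w r * y' r) (at r within {p..q})"
      if "r \<in> {p..q}" for r
      unfolding has_real_derivative_iff_has_vector_derivative[symmetric]
      by (rule DERIV_cong[OF DERIV_mult[OF w[OF that] y[OF that]]]) simp
  qed
  then have "integral {p..q} (\<lambda>r. w' r * y r + w r * y' r) = w q * y q - w p * y p"
    by (rule integral_unique)
  moreover have "integral {p..q} (\<lambda>r. w' r * y r + w r * y' r) =
      integral {p..q} (\<lambda>r. w' r * y r) + integral {p..q} (\<lambda>r. w r * y' r)"
    using assms(4,5) cont
    by (intro integral_add integrable_continuous_real continuous_on_mult)
  ultimately show ?thesis
    by simp
qed

text \<open>The equivalence holds point by point: integration by parts along the two characteristics through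
\<open>(s, t)\<close> moves the derivative from \<open>x\<close> to the weight and leaves the boundary integrals alone.\<close>

lemma unified_equation_iff_characteristic_relation:
  assumes c: "c > 0"
    and l: "\<And>r. r \<ge> c \<Longrightarrow> (l has_real_derivative l' r) (at r within {c..})"
    and l': "continuous_on {c..} l'"
    and x: "C1_on (Omega_bar c) x"
  shows "unified_equation c l l' x \<longleftrightarrow>
    (\<forall>(s, t) \<in> Omega_bar c. characteristic_relation c (weighted_Ds c l x) (weighted_Dt c l x) s t)"
proof -
  have x_s: "continuous_on (Omega_bar c) (\<lambda>z. Ds (Omega_bar c) x (fst z) (snd z))"
    and x_t: "continuous_on (Omega_bar c) (\<lambda>z. Dt (Omega_bar c) x (fst z) (snd z))"
    using x by (auto simp: C1_on_def case_prod_unfold)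
  have l_shift: "((\<lambda>r. l (r + k)) has_real_derivative l' (r + k)) (at r within {p..q})"
    if "r \<in> {p..q}" "c \<le> p + k" for r k p q
  proof -
    have "((\<lambda>r. l (r + k)) has_real_derivative l' (r + k) * 1) (at r within {p..q})"
    proof (rule DERIV_image_chain[of l _ "\<lambda>r. r + k", unfolded o_def])
      show "(l has_real_derivative l' (r + k)) (at (r + k) within (\<lambda>r. r + k) ` {p..q})"
        by (rule DERIV_subset[OF l]) (use that in auto)
    qed (auto intro!: derivative_eq_intros)
    then show ?thesis
      by simp
  qed
  have l'_shift: "continuous_on {p..q} (\<lambda>r. l' (r + k))" if "c \<le> p + k" for k p q
    using that by (intro continuous_on_compose2[OF l'] continuous_intros) auto
  have "(2 * l (s + t) * x s t =
       integral {pos_part (c - t)..s} (\<lambda>\<sigma>. l' (\<sigma> + t) * x \<sigma> t)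
     + integral {pos_part (c - s)..t} (\<lambda>\<tau>. l' (s + \<tau>) * x s \<tau>)
     + l (max c t) * x (pos_part (c - t)) t
     + l (max s c) * x s (pos_part (c - s))
     + integral {pos_part (c - t)..min c s}
         (\<lambda>\<sigma>. l c * (Ds (Omega_bar c) x \<sigma> (c - \<sigma>) + Dt (Omega_bar c) x \<sigma> (c - \<sigma>)))
     + integral {min c s..s}
         (\<lambda>\<sigma>. l (\<sigma> + pos_part (c - s)) * Ds (Omega_bar c) x \<sigma> (pos_part (c - s)))
     + integral {min c t..t}
         (\<lambda>\<tau>. l (pos_part (c - t) + \<tau>) * Dt (Omega_bar c) x (pos_part (c - t)) \<tau>))
    \<longleftrightarrow> characteristic_relation c (weighted_Ds c l x) (weighted_Dt c l x) s t"
    if st: "(s, t) \<in> Omega_bar c" for s t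
  proof -
    let ?p = "pos_part (c - t)" and ?q = "pos_part (c - s)"
    have st': "0 \<le> s" "0 \<le> t" "c \<le> s + t" and pq: "?p \<le> s" "?q \<le> t" "0 \<le> ?p" "0 \<le> ?q"
      "c \<le> ?p + t" "c \<le> s + ?q" "?p + t = max c t" "s + ?q = max s c"
      using st c by (auto simp: Omega_bar_def)
    have row: "(\<sigma>, t) \<in> Omega_bar c" if "?p \<le> \<sigma>" for \<sigma>
      using that st' by (auto simp: Omega_bar_def)
    have column: "(s, \<tau>) \<in> Omega_bar c" if "?q \<le> \<tau>" for \<tau>
      using that st' by (auto simp: Omega_bar_def)
    have "integral {?p..s} (\<lambda>\<sigma>. l (\<sigma> + t) * Ds (Omega_bar c) x \<sigma> t) =
        l (s + t) * x s t - l (?p + t) * x ?p t - integral {?p..s} (\<lambda>\<sigma>. l' (\<sigma> + t) * x \<sigma> t)"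
      by (intro integral_weighted_derivative l_shift l'_shift pq
          DERIV_subset[OF C1_on_partials(1)[OF x]]
          continuous_on_compose2[OF x_s, of _ "\<lambda>\<sigma>. (\<sigma>, t)", simplified] continuous_intros)
        (auto intro!: row)
    moreover have "integral {?q..t} (\<lambda>\<tau>. l (s + \<tau>) * Dt (Omega_bar c) x s \<tau>) =
        l (s + t) * x s t - l (s + ?q) * x s ?q - integral {?q..t} (\<lambda>\<tau>. l' (s + \<tau>) * x s \<tau>)"
      unfolding add.commute[of s] using pq(6)
      by (intro integral_weighted_derivative l_shift l'_shift pq
          DERIV_subset[OF C1_on_partials(2)[OF x]]
          continuous_on_compose2[OF x_t, of _ "\<lambda>\<tau>. (s, \<tau>)", simplified] continuous_intros)
        (auto intro!: column simp: add.commute)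
    moreover have "integral {?p..min c s} (\<lambda>\<sigma>. weighted_Ds c l x \<sigma> (c - \<sigma>) + weighted_Dt c l x \<sigma> (c - \<sigma>)) =
        integral {?p..min c s} (\<lambda>\<sigma>. l c * (Ds (Omega_bar c) x \<sigma> (c - \<sigma>) + Dt (Omega_bar c) x \<sigma> (c - \<sigma>)))"
      by (simp add: distrib_left)
    \<comment> \<open>The two relations now have the same boundary integrals, and the end-point terms at
      \<open>(s, t)\<close> add up to \<open>2 * l (s + t) * x s t\<close>.\<close>
    ultimately show ?thesis
      unfolding characteristic_relation_def pq(7,8)[symmetric] by (intro iffI; linarith)
  qed
  then show ?thesis
    unfolding unified_equation_def by (intro ball_cong refl) auto
qed

section \<open>Classical solutions\<close>

lemma open_Omega: "open (Omega c)"
proof -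
  have "Omega c = {z. 0 < fst z} \<inter> {z. 0 < snd z} \<inter> {z. c < fst z + snd z}"
    by (auto simp: Omega_def)
  then show ?thesis
    by (simp only:) (intro open_Int open_Collect_less continuous_intros)
qed

lemma at_within_slice:
  assumes "(s, t) \<in> Omega c" and "Omega c \<subseteq> S"
  shows "at s within {\<sigma>. (\<sigma>, t) \<in> S} = at s" and "at t within {\<tau>. (s, \<tau>) \<in> S} = at t"
proof -
  have "open ((\<lambda>\<sigma>. (\<sigma>, t)) -` Omega c)" "open ((\<lambda>\<tau>. (s, \<tau>)) -` Omega c)"
    by (intro open_vimage open_Omega continuous_intros)+
  then have slices: "open {\<sigma>. (\<sigma>, t) \<in> Omega c}" "open {\<tau>. (s, \<tau>) \<in> Omega c}"
    by (simp_all add: vimage_def)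
  show "at s within {\<sigma>. (\<sigma>, t) \<in> S} = at s"
    by (intro at_within_interior interiorI[OF slices(1)]) (use assms in auto)
  show "at t within {\<tau>. (s, \<tau>) \<in> S} = at t"
    by (intro at_within_interior interiorI[OF slices(2)]) (use assms in auto)
qed

text \<open>Links the derivatives in the differential equation, taken in the open domain, to those in the
integral relations, taken in the closed one.\<close>

lemma Ds_Dt_Omega_bar_eq:
  assumes "(s, t) \<in> Omega c"
  shows "Ds (Omega_bar c) x s t = Ds (Omega c) x s t" and "Dt (Omega_bar c) x s t = Dt (Omega c) x s t"
proof -
  have "Omega c \<subseteq> Omega_bar c"
    by (auto simp: Omega_def Omega_bar_def)
  then show "Ds (Omega_bar c) x s t = Ds (Omega c) x s t" and "Dt (Omega_bar c) x s t = Dt (Omega c) x s t"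
    using assms by (simp_all add: Ds_def Dt_def at_within_slice)
qed

lemma C1_on_Omega_partials:
  assumes "C1_on (Omega c) x" and "(s, t) \<in> Omega c"
  shows "((\<lambda>\<sigma>. x \<sigma> t) has_real_derivative Ds (Omega c) x s t) (at s)"
    and "((\<lambda>\<tau>. x s \<tau>) has_real_derivative Dt (Omega c) x s t) (at t)"
  using C1_on_partials[OF assms] assms(2) by (simp_all add: at_within_slice)

text \<open>Inside the domain the differential equation makes \<open>a d\<sigma> - b d\<tau>\<close> closed, where \<open>a\<close> and \<open>b\<close> are the
weighted derivatives of \<open>x\<close>. Second derivatives need not extend to the boundary, so the potential is
used for the fields translated by \<open>(e, e)\<close>, followed by the limit \<open>e -> 0\<close>.\<close>

lemma classical_solution_characteristic_relation:
  assumes c: "c > 0"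
    and l: "\<And>r. r \<ge> c \<Longrightarrow> (l has_real_derivative l' r) (at r within {c..})"
    and l': "continuous_on {c..} l'"
    and sol: "classical_solution c l l' g h f n x"
    and st: "(s, t) \<in> Omega_bar c"
  shows "characteristic_relation c (weighted_Ds c l x) (weighted_Dt c l x) s t"
proof (rule characteristic_relation_limit[OF c st])
  have x_bar: "C1_on (Omega_bar c) x"
    and x: "C1_on (Omega c) x" and xs: "C1_on (Omega c) (Ds (Omega c) x)" and xt: "C1_on (Omega c) (Dt (Omega c) x)"
    using sol by (auto simp: classical_solution_def C2_on_def)
  have l_cont: "continuous_on {c..} l"
    using DERIV_continuous_on[of "{c..}" l l'] l by auto
  show "continuous_on (Omega_bar c) (\<lambda>(s, t). weighted_Ds c l x s t)"
    and "continuous_on (Omega_bar c) (\<lambda>(s, t). weighted_Dt c l x s t)"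
    using x_bar by (intro continuous_on_weighted l_cont; simp add: C1_on_def)+
  define a where "a = (\<lambda>s t. l (s + t) * Ds (Omega c) x s t)"
  define b where "b = (\<lambda>s t. l (s + t) * Dt (Omega c) x s t)"
  define m where "m = (\<lambda>s t. l' (s + t) * Ds (Omega c) x s t + l (s + t) * Dt (Omega c) (Ds (Omega c) x) s t)"
  have sum_cont: "continuous_on (Omega c) (\<lambda>z. k (fst z + snd z))" if "continuous_on {c..} k" for k :: "real \<Rightarrow> real"
    by (intro continuous_on_compose2[OF that] continuous_intros) (auto simp: Omega_def)
  have a_cont: "continuous_on (Omega c) (\<lambda>(s, t). a s t)"
    and b_cont: "continuous_on (Omega c) (\<lambda>(s, t). b s t)"
    and m_cont: "continuous_on (Omega c) (\<lambda>(s, t). m s t)"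
    using x xs l_cont l' unfolding C1_on_def a_def b_def m_def case_prod_unfold
    by (intro continuous_intros sum_cont; simp)+
  have l_at: "(l has_real_derivative l' (s + t)) (at (s + t))" if "(s, t) \<in> Omega c" for s t
  proof -
    have "s + t \<in> interior {c..}"
      using that by (auto simp: Omega_def)
    then show ?thesis
      using l[of "s + t"] that at_within_interior[of "s + t" "{c..}"] by (auto simp: Omega_def)
  qed
  have l_s: "((\<lambda>\<sigma>. l (\<sigma> + t)) has_real_derivative l' (s + t)) (at s)"
    and l_t: "((\<lambda>\<tau>. l (s + \<tau>)) has_real_derivative l' (s + t)) (at t)" if "(s, t) \<in> Omega c" for s t
    using l_at[OF that] DERIV_shift[of l "l' (s + t)" s t] DERIV_shift[of l "l' (s + t)" t s]
    by (simp_all add: add.commute)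
  have a_t: "((\<lambda>\<tau>. a s \<tau>) has_real_derivative m s t) (at t)" if "(s, t) \<in> Omega c" for s t
    unfolding a_def m_def
    by (rule DERIV_cong[OF DERIV_mult[OF l_t[OF that] C1_on_Omega_partials(2)[OF xs that]]]) simp
  \<comment> \<open>The differential equation says exactly that \<open>a d\<sigma> - b d\<tau>\<close> is closed.\<close>
  have b_s: "((\<lambda>\<sigma>. b \<sigma> t) has_real_derivative - m s t) (at s)" if "(s, t) \<in> Omega c" for s t
  proof -
    have x_ts: "((\<lambda>\<sigma>. Dt (Omega c) x \<sigma> t) has_real_derivative Dt (Omega c) (Ds (Omega c) x) s t) (at s)"
      using xs by (intro mixed_partials_commute[OF open_Omega that, of x "Ds (Omega c) x"]
          C1_on_Omega_partials x) (auto simp: C1_on_def)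
    have "((\<lambda>\<sigma>. b \<sigma> t) has_real_derivative
        l' (s + t) * Dt (Omega c) x s t + l (s + t) * Dt (Omega c) (Ds (Omega c) x) s t) (at s)"
      unfolding b_def
      by (rule DERIV_cong[OF DERIV_mult[OF l_s[OF that] x_ts]]) simp
    moreover have "2 * l (s + t) * Dt (Omega c) (Ds (Omega c) x) s t
        + l' (s + t) * (Ds (Omega c) x s t + Dt (Omega c) x s t) = 0"
      using sol that by (auto simp: classical_solution_def)
    then have "l' (s + t) * Dt (Omega c) x s t + l (s + t) * Dt (Omega c) (Ds (Omega c) x) s t = - m s t"
      by (simp add: m_def algebra_simps)
    ultimately show ?thesis
      by simp
  qed
  show "characteristic_relation c (\<lambda>\<sigma> \<tau>. weighted_Ds c l x (\<sigma> + e) (\<tau> + e))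
      (\<lambda>\<sigma> \<tau>. weighted_Dt c l x (\<sigma> + e) (\<tau> + e)) s t" if e: "0 < e" for e
  proof -
    \<comment> \<open>All shifted points met below have first coordinate at most \<open>s + e\<close> and second coordinate
      at least \<open>e\<close>, so they lie strictly inside the region in which the potential is defined.\<close>
    define M where "M = c + s + e + 1"
    have "0 \<le> s"
      using st by (auto simp: Omega_bar_def)
    have "(M, \<tau>) \<in> Omega c" if "e / 2 \<le> \<tau>" for \<tau>
      using that e c \<open>0 \<le> s\<close> by (auto simp: Omega_def M_def)
    moreover have "(\<sigma>', \<tau>) \<in> Omega c" if "(\<sigma>, \<tau>) \<in> Omega c" "\<sigma> \<le> \<sigma>'" for \<sigma> \<sigma>' \<tau>
      using that by (auto simp: Omega_def)
    ultimately obtain \<phi> where \<phi>: "\<And>\<sigma> \<tau>. (\<sigma>, \<tau>) \<in> Omega c \<Longrightarrow> \<sigma> < M \<Longrightarrow> e / 2 < \<tau> \<Longrightarrow>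
        (\<phi> has_derivative (\<lambda>(u, v). a \<sigma> \<tau> * u - b \<sigma> \<tau> * v)) (at (\<sigma>, \<tau>))"
      using closed_field_has_potential[OF open_Omega _ _ a_cont b_cont m_cont a_t b_s, of "e / 2" M]
      by blast
    show ?thesis
    proof (rule characteristic_relation_of_potential[OF c st, of "\<lambda>z. \<phi> (z + (e, e))"])
      fix \<sigma> \<tau> assume *: "(\<sigma>, \<tau>) \<in> Omega_bar c" "\<sigma> \<le> s"
      then have in_Omega: "(\<sigma> + e, \<tau> + e) \<in> Omega c" "\<sigma> + e < M" "e / 2 < \<tau> + e"
        using e c by (auto simp: Omega_bar_def Omega_def M_def)
      have shift: "((\<lambda>z. z + (e, e)) has_derivative (\<lambda>z. z)) (at (\<sigma>, \<tau>))"
        by (auto intro!: derivative_eq_intros)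
      have "((\<lambda>z. \<phi> (z + (e, e))) has_derivative
          (\<lambda>(u, v). a (\<sigma> + e) (\<tau> + e) * u - b (\<sigma> + e) (\<tau> + e) * v)) (at (\<sigma>, \<tau>))"
        by (rule has_derivative_compose[OF shift]) (use \<phi>[OF in_Omega] in simp)
      then show "((\<lambda>z. \<phi> (z + (e, e))) has_derivative
          (\<lambda>(u, v). weighted_Ds c l x (\<sigma> + e) (\<tau> + e) * u - weighted_Dt c l x (\<sigma> + e) (\<tau> + e) * v)) (at (\<sigma>, \<tau>))"
        using in_Omega by (simp add: a_def b_def Ds_Dt_Omega_bar_eq)
    qed
  qed
qed

section \<open>The integral relations and the unified equation\<close>

theorem proposition5p5:
  fixes c :: real
    and l l' g h f n :: "real \<Rightarrow> real"
    and x :: "real \<Rightarrow> real \<Rightarrow> real"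
  assumes "c > 0"
    and "\<And>r. r \<ge> c \<Longrightarrow> (l has_real_derivative l' r) (at r within {c..})"
    and "continuous_on {c..} l'"
    and "\<And>r. r \<ge> c \<Longrightarrow> l r \<noteq> 0"
  shows "(classical_solution c l l' g h f n x \<longrightarrow>
            integral_relations c l n x \<and> unified_equation c l l' x) \<and>
         (C1_on (Omega_bar c) x \<and>
          (\<forall>s\<in>{0..c}. Ds (Omega_bar c) x s (c - s) + Dt (Omega_bar c) x s (c - s) = n s) \<longrightarrow>
            (integral_relations c l n x \<longleftrightarrow> unified_equation c l l' x))"
proof -
  have l_cont: "continuous_on {c..} l"
    using DERIV_continuous_on[of "{c..}" l l'] assms(2) by auto
  let ?R = "\<forall>(s, t) \<in> Omega_bar c. characteristic_relation c (weighted_Ds c l x) (weighted_Dt c l x) s t"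
  have forms: "(integral_relations c l n x \<longleftrightarrow> ?R) \<and> (unified_equation c l l' x \<longleftrightarrow> ?R)"
    if "C1_on (Omega_bar c) x"
      "\<forall>s\<in>{0..c}. Ds (Omega_bar c) x s (c - s) + Dt (Omega_bar c) x s (c - s) = n s"
    using integral_relations_iff_characteristic_relation[OF assms(1) l_cont that(1)]
      unified_equation_iff_characteristic_relation[OF assms(1-3) that(1)] that(2) by blast
  moreover have "C1_on (Omega_bar c) x \<and>
      (\<forall>s\<in>{0..c}. Ds (Omega_bar c) x s (c - s) + Dt (Omega_bar c) x s (c - s) = n s) \<and> ?R"
    if "classical_solution c l l' g h f n x"
    using classical_solution_characteristic_relation[OF assms(1-3) that] that
    unfolding classical_solution_def by auto
  ultimately show ?thesis
    by blast
qed

end
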